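(* Let $\mathcal{C}:=\{\lambda\in\mathbb{C} : R_\lambda \text{ is convex}\}$ and $\mathcal{D}:=\mathbb{C}\setminus\mathcal{C}$. The set $\mathcal{D}$ has no accumulation points in $\mathbb{C}$. That is, for any $\lambda\in\mathbb{C}$ there exists an open neighborhood $N$ of $\lambda$ such that $N\setminus\{\lambda\}\subseteq\mathcal{C}$.
   Context: For $\lambda\in\mathbb{C}$, a set $S\subseteq\mathbb{C}$ is $\lambda$-convex if for all $a,b\in S$ the point $(1-\lambda)a+\lambda b$ is in $S$; it is $\lambda$-clonvex if it is $\lambda$-convex and topologically closed in $\mathbb{C}$. $R_\lambda$ denotes the smallest $\lambda$-clonvex set containing $\{0,1\}$. "Convex" has the usual meaning. *)

theory Defs
  imports "HOL-Analysis.Analysis"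
begin

definition lam_convex :: "complex \<Rightarrow> complex set \<Rightarrow> bool" where
  "lam_convex l S \<longleftrightarrow> (\<forall>a\<in>S. \<forall>b\<in>S. (1 - l) * a + l * b \<in> S)"

definition lam_clonvex :: "complex \<Rightarrow> complex set \<Rightarrow> bool" where
  "lam_clonvex l S \<longleftrightarrow> lam_convex l S \<and> closed S"

definition R :: "complex \<Rightarrow> complex set" where
  "R l = lam_clonvex l hull {0, 1}"

lemma R_smallest:
  "lam_clonvex l (R l)"
  "{0, 1} \<subseteq> R l"
  "lam_clonvex l S \<Longrightarrow> {0, 1} \<subseteq> S \<Longrightarrow> R l \<subseteq> S"
proof -
  have Inter: "lam_clonvex l (\<Inter>F)" if F: "\<And>S. S \<in> F \<Longrightarrow> lam_clonvex l S" for F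
    unfolding lam_clonvex_def lam_convex_def
  proof (intro conjI ballI InterI closed_Inter)
    fix a b S assume "a \<in> \<Inter>F" "b \<in> \<Inter>F" "S \<in> F"
    then have "a \<in> S" "b \<in> S" by blast+
    with F[OF \<open>S \<in> F\<close>] show "(1 - l) * a + l * b \<in> S"
      unfolding lam_clonvex_def lam_convex_def by blast
  next
    fix S assume "S \<in> F"
    from F[OF this] show "closed S" unfolding lam_clonvex_def by (rule conjunct2)
  qed
  show "lam_clonvex l (R l)"
    unfolding R_def by (rule hull_in) (rule Inter, blast)
  show "{0, 1} \<subseteq> R l"
    unfolding R_def by (rule hull_subset)
  show "R l \<subseteq> S" if "lam_clonvex l S" "{0, 1} \<subseteq> S"
    unfolding R_def using that(2,1) by (rule hull_minimal)
qed

definition C_set :: "complex set" where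
  "C_set = {l. convex (R l)}"

definition D_set :: "complex set" where
  "D_set = - C_set"

end

theory Submission
  imports Defs
begin

text \<open>For \<open>t \<in> R l\<close> the set \<open>R l\<close> is \<open>t\<close>-convex, so \<open>R t \<subseteq> R l\<close>, and \<open>l \<in> C_set\<close> as soon as
  \<open>R l\<close> contains some \<open>x\<close> with \<open>0 < \<bar>x\<bar> < 1\<close>: a power \<open>y\<close> of \<open>x\<close> can be made small with direction close
  to \<open>1\<close>, and the points \<open>1 - (1 - y)\<^sup>k\<close> then trace out the unit interval.

  It even suffices that two distinct points of \<open>R l\<close> are at distance less than \<open>1\<close>. Products of
  differences of elements of \<open>R l\<close> are again differences, so there are \<open>f, f + \<Delta> \<in> R l\<close> with \<open>\<Delta>\<close>
  arbitrarily small, and \<open>f + \<Delta> R l \<subseteq> R l\<close>. Taking \<open>s\<close>, \<open>u\<close> from a part of \<open>R l\<close> that is coarsely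
  dense in a disc, the points \<open>(1 - t) s + t (f + \<Delta> u)\<close> are dense in the same disc at a finer scale,
  and in the limit \<open>R l\<close> contains the disc, hence \<open>1/2\<close>.

  Two such points exist for all \<open>l\<close> in a punctured neighbourhood of any \<open>l\<^sub>0\<close>, because by pigeonhole two
  distinct polynomials with values in \<open>R l\<close> differ by less than \<open>1\<close> at \<open>l\<^sub>0\<close>, and their difference has
  only finitely many zeros.\<close>

section \<open>Closure properties of \<open>R l\<close>\<close>

text \<open>For fixed endpoints \<open>a\<close> and \<open>b\<close>, the admissible
  \<open>t\<close> form a closed \<open>l\<close>-convex set, because interpolation is affine in
  \<open>t\<close>. It contains 0 and 1, so minimality of \<open>R l\<close> applies.\<close>

lemma R_affine:
  assumes "a \<in> R l" "b \<in> R l" "t \<in> R l"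
  shows "(1 - t) * a + t * b \<in> R l"
proof -
  let ?S = "{t. (1 - t) * a + t * b \<in> R l}"
  have lc: "lam_convex l (R l)" and cl: "closed (R l)"
    using R_smallest(1)[of l] by (auto simp: lam_clonvex_def)
  have "lam_convex l ?S"
    unfolding lam_convex_def
  proof (intro ballI)
    fix s t assume "s \<in> ?S" "t \<in> ?S"
    then have "(1 - l) * ((1 - s) * a + s * b) + l * ((1 - t) * a + t * b) \<in> R l"
      using lc by (simp add: lam_convex_def)
    also have "(1 - l) * ((1 - s) * a + s * b) + l * ((1 - t) * a + t * b)
      = (1 - ((1 - l) * s + l * t)) * a + ((1 - l) * s + l * t) * b"
      by (simp add: algebra_simps)
    finally show "(1 - l) * s + l * t \<in> ?S" by simp
  qed
  moreover have "closed ?S"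
  proof -
    have "closed ((\<lambda>t. (1 - t) * a + t * b) -` R l)"
      by (rule closed_vimage[OF cl]) (intro continuous_intros)
    then show ?thesis by (simp add: vimage_def)
  qed
  ultimately have "R l \<subseteq> ?S"
    using assms by (intro R_smallest(3)) (auto simp: lam_clonvex_def)
  with assms show ?thesis by auto
qed

lemma R_closed: "closed (R l)"
  using R_smallest(1)[of l] by (auto simp: lam_clonvex_def)

lemma R_0 [simp]: "0 \<in> R l" and R_1 [simp]: "1 \<in> R l"
  using R_smallest(2)[of l] by auto

lemma R_self [simp]: "l \<in> R l"
proof -
  have "(1 - l) * 0 + l * 1 \<in> R l"
    using R_smallest(1)[of l] unfolding lam_clonvex_def lam_convex_def by (metis R_0 R_1)
  then show ?thesis by simp
qed

lemma R_mult: "a \<in> R l \<Longrightarrow> b \<in> R l \<Longrightarrow> a * b \<in> R l"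
  using R_affine[of 0 l b a] by simp

lemma R_power: "a \<in> R l \<Longrightarrow> a ^ n \<in> R l"
  by (induction n) (auto intro: R_mult)

lemma R_diff: "a \<in> R l \<Longrightarrow> 1 - a \<in> R l"
  using R_affine[of 1 l 0 a] by simp

section \<open>Small elements force convexity\<close>

lemma convex_R_if_unit_interval:
  assumes "\<And>t::real. 0 \<le> t \<Longrightarrow> t \<le> 1 \<Longrightarrow> of_real t \<in> R l"
  shows "l \<in> C_set"
  unfolding C_set_def mem_Collect_eq convex_alt
proof (intro ballI allI impI)
  fix x y and u :: real
  assume "x \<in> R l" "y \<in> R l" "0 \<le> u \<and> u \<le> 1"
  then have "(1 - of_real u) * x + of_real u * y \<in> R l"
    by (intro R_affine assms) auto
  then show "(1 - u) *\<^sub>R x + u *\<^sub>R y \<in> R l"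
    by (simp add: scaleR_conv_of_real)
qed

text \<open>By compactness of the unit circle the powers of \<open>sgn x\<close> have a convergent
  subsequence, along exponents \<open>r\<close>. Quotients of its terms tend to 1, and the exponent
  gaps \<open>r (2 * j) - r j\<close> are at least \<open>j\<close>, hence unbounded.\<close>

lemma powers_with_direction_to_1:
  fixes x :: complex
  assumes "x \<noteq> 0"
  obtains m :: "nat \<Rightarrow> nat"
  where "filterlim m at_top sequentially" "(\<lambda>j. sgn (x ^ m j)) \<longlonglongrightarrow> 1"
proof -
  let ?u = "sgn x"
  have u: "norm ?u = 1" using assms by (simp add: norm_sgn)
  have "\<forall>n. ?u ^ n \<in> sphere 0 1" using u by (simp add: norm_power)
  then obtain v r where v: "v \<in> sphere 0 1" "strict_mono (r :: nat \<Rightarrow> nat)"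
    "((\<lambda>n. ?u ^ n) \<circ> r) \<longlonglongrightarrow> v"
    using compact_sphere[of "0::complex" 1] unfolding compact_def by metis
  define m where "m j = r (2 * j) - r j" for j
  have mj: "r j + m j = r (2 * j)" for j
    using strict_mono_mono[OF v(2)] by (simp add: m_def mono_def)
  have "m j \<ge> j" for j
  proof -
    have "r k + j \<le> r (k + j)" for k j
    proof (induction j)
      case (Suc j)
      have "r (k + j) < r (k + Suc j)" using v(2) by (simp add: strict_mono_def)
      with Suc show ?case by simp
    qed simp
    from this[of j j] show ?thesis by (simp add: m_def mult_2)
  qed
  then have "filterlim m at_top sequentially"
    by (intro filterlim_at_top_mono[OF filterlim_ident]) auto
  moreover have "(\<lambda>j. sgn (x ^ m j)) \<longlonglongrightarrow> 1"
  proof -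
    have 1: "(\<lambda>j. ?u ^ r j) \<longlonglongrightarrow> v" using v(3) by (simp add: o_def)
    have "(\<lambda>j. ?u ^ r (2 * j)) \<longlonglongrightarrow> v"
      using LIMSEQ_subseq_LIMSEQ[OF 1, of "\<lambda>j. 2 * j"] by (simp add: o_def strict_mono_def)
    moreover have "v \<noteq> 0" using v(1) by auto
    ultimately have "(\<lambda>j. ?u ^ r (2 * j) / ?u ^ r j) \<longlonglongrightarrow> v / v"
      using 1 by (intro tendsto_divide)
    moreover have "?u ^ r (2 * j) / ?u ^ r j = sgn (x ^ m j)" for j
    proof -
      have "?u ^ r (2 * j) = ?u ^ r j * ?u ^ m j" by (metis mj power_add)
      moreover have "?u \<noteq> 0" using assms by (simp add: sgn_zero_iff)
      moreover have "?u ^ m j = sgn (x ^ m j)"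
        by (simp add: sgn_div_norm norm_power power_mult_distrib scaleR_conv_of_real power_inverse)
      ultimately show ?thesis by simp
    qed
    ultimately show ?thesis using \<open>v \<noteq> 0\<close> by simp
  qed
  ultimately show ?thesis by (rule that)
qed

lemma Ln_quotient: "((\<lambda>y. Ln (1 - y) / y) \<longlongrightarrow> -1) (at (0::complex))"
proof -
  have "((\<lambda>y. Ln (1 - y)) has_field_derivative -1) (at 0)"
    by (auto intro!: derivative_eq_intros)
  then show ?thesis by (simp add: has_field_derivative_iff)
qed

lemma floor_multiple_tendsto:
  fixes h :: "nat \<Rightarrow> real"
  assumes "h \<longlonglongrightarrow> 0" "\<And>j. h j > 0" "s \<ge> 0"
  shows "(\<lambda>j. real (nat \<lfloor>s / h j\<rfloor>) * h j) \<longlonglongrightarrow> s"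
proof (rule tendsto_sandwich)
  have floor: "s / h j - 1 \<le> real (nat \<lfloor>s / h j\<rfloor>)" "real (nat \<lfloor>s / h j\<rfloor>) \<le> s / h j" for j
    using assms(2)[of j] assms(3) by (linarith, intro of_nat_floor) auto
  have "s - h j \<le> real (nat \<lfloor>s / h j\<rfloor>) * h j" "real (nat \<lfloor>s / h j\<rfloor>) * h j \<le> s" for j
  proof -
    have "s / h j * h j = s" using assms(2)[of j] by simp
    then show "s - h j \<le> real (nat \<lfloor>s / h j\<rfloor>) * h j" "real (nat \<lfloor>s / h j\<rfloor>) * h j \<le> s"
      using mult_right_mono[OF floor(1)[of j], of "h j"] mult_right_mono[OF floor(2)[of j], of "h j"]
        assms(2)[of j] by (simp_all add: left_diff_distrib)
  qed
  then show "\<forall>\<^sub>F j in sequentially. s - h j \<le> real (nat \<lfloor>s / h j\<rfloor>) * h j"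
    "\<forall>\<^sub>F j in sequentially. real (nat \<lfloor>s / h j\<rfloor>) * h j \<le> s" by auto
  show "(\<lambda>j. s - h j) \<longlonglongrightarrow> s" using tendsto_diff[OF tendsto_const assms(1), of s] by simp
qed auto

lemma small_element_imp_C:
  assumes x: "x \<in> R l" "x \<noteq> 0" "norm x < 1"
  shows "l \<in> C_set"
proof (rule convex_R_if_unit_interval)
  fix t :: real
  assume t: "0 \<le> t" "t \<le> 1"
  show "of_real t \<in> R l"
  proof (cases "t = 1")
    case False
    \<comment> \<open>With \<open>k j * y j\<close> tending to \<open>s\<close> and
      \<open>Ln (1 - y) / y\<close> tending to -1, the powers \<open>(1 - y j) ^ k j\<close> tend to
      \<open>exp (- s) = 1 - t\<close>. The value \<open>t = 1\<close> has no finite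
      \<open>s\<close> and is treated apart.\<close>
    define s where "s = - ln (1 - t)"
    have s: "s \<ge> 0" "exp (- s) = 1 - t" using t False by (auto simp: s_def)
    obtain m :: "nat \<Rightarrow> nat" where m: "filterlim m at_top sequentially"
      "(\<lambda>j. sgn (x ^ m j)) \<longlonglongrightarrow> 1"
      using powers_with_direction_to_1[OF x(2)] .
    define y where "y j = x ^ m j" for j
    define k where "k j = nat \<lfloor>s / norm (y j)\<rfloor>" for j
    have y0: "y j \<noteq> 0" for j using x by (simp add: y_def)
    have ylim: "y \<longlonglongrightarrow> 0"
      unfolding y_def using filterlim_compose[OF LIMSEQ_power_zero[OF x(3)] m(1)] .
    have "(\<lambda>j. real (k j) * norm (y j)) \<longlonglongrightarrow> s"
      unfolding k_def using y0 s(1) tendsto_norm_zero[OF ylim]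
      by (intro floor_multiple_tendsto) auto
    then have "(\<lambda>j. of_real (real (k j) * norm (y j)) * sgn (y j)) \<longlonglongrightarrow> of_real s * 1"
      using m(2) unfolding y_def[symmetric] by (intro tendsto_intros)
    moreover have "of_real (real (k j) * norm (y j)) * sgn (y j) = of_nat (k j) * y j" for j
      using y0[of j] by (simp add: sgn_div_norm scaleR_conv_of_real field_simps)
    ultimately have kl: "(\<lambda>j. of_nat (k j) * y j) \<longlonglongrightarrow> of_real s"
      by (simp only: mult_1_right)
    have "filterlim y (at 0) sequentially"
      using ylim y0 by (simp add: filterlim_at)
    from filterlim_compose[OF Ln_quotient this]
    have "(\<lambda>j. Ln (1 - y j) / y j) \<longlonglongrightarrow> -1" .
    from tendsto_mult[OF kl this]
    have "(\<lambda>j. of_nat (k j) * y j * (Ln (1 - y j) / y j)) \<longlonglongrightarrow> - of_real s" by simp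
    then have "(\<lambda>j. 1 - exp (of_nat (k j) * y j * (Ln (1 - y j) / y j))) \<longlonglongrightarrow> 1 - exp (- of_real s)"
      by (intro tendsto_intros)
    also have "1 - exp (- of_real s) = (of_real t :: complex)"
      using s(2) by (metis exp_of_real of_real_1 of_real_diff of_real_minus diff_diff_eq2 add_diff_cancel_left')
    finally have lim: "(\<lambda>j. 1 - exp (of_nat (k j) * y j * (Ln (1 - y j) / y j))) \<longlonglongrightarrow> of_real t" .
    have "\<forall>\<^sub>F j in sequentially. norm (y j) < 1"
      using tendsto_norm_zero[OF ylim] by (rule order_tendstoD) simp
    then have "\<forall>\<^sub>F j in sequentially. 1 - exp (of_nat (k j) * y j * (Ln (1 - y j) / y j)) \<in> R l"
    proof eventually_elim
      case (elim j)
      then have "1 - y j \<noteq> 0" by auto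
      then have "exp (of_nat (k j) * y j * (Ln (1 - y j) / y j)) = (1 - y j) ^ k j"
        using y0[of j] by (simp add: exp_of_nat_mult)
      then show ?case using x(1) by (simp add: y_def R_diff R_power)
    qed
    with R_closed lim show ?thesis by (intro Lim_in_closed_set) auto
  qed simp
qed

section \<open>Bernstein sums and a pigeonhole argument\<close>

definition bern_sum :: "(nat \<Rightarrow> nat) \<Rightarrow> nat \<Rightarrow> complex \<Rightarrow> complex" where
  "bern_sum e n l = (\<Sum>k\<le>n. of_nat (e k) * l ^ k * (1 - l) ^ (n - k))"

text \<open>The clone generated by \<open>0\<close>, \<open>1\<close> consists of the acceptance probabilities of decision trees
  over coins of bias \<open>l\<close>; a tree of depth \<open>n\<close> may accept any \<open>e k\<close> of the \<open>n choose k\<close> outcomes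
  with \<open>k\<close> heads.\<close>

lemma bern_sum_in_R:
  assumes "\<And>k. k \<le> n \<Longrightarrow> e k \<le> n choose k"
  shows "bern_sum e n l \<in> R l"
  using assms
proof (induction n arbitrary: e)
  case 0
  then have "e 0 = 0 \<or> e 0 = 1" by (metis binomial_n_0 le_Suc_eq le_zero_eq One_nat_def)
  then show ?case by (auto simp: bern_sum_def)
next
  case (Suc n)
  \<comment> \<open>The root of the tree is one coin: \<open>c\<close> counts the accepted outcomes
    sent to the tails branch, filled greedily, and \<open>d\<close> those left for the heads branch.
    Pascal's rule shows that the heads branch has room for them.\<close>
  define c where "c k = min (e k) (n choose k)" for k
  define d where "d k = e (Suc k) - c (Suc k)" for k
  have c: "bern_sum c n l \<in> R l" by (rule Suc.IH) (simp add: c_def)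
  have d: "bern_sum d n l \<in> R l"
  proof (rule Suc.IH)
    fix k assume "k \<le> n"
    then show "d k \<le> n choose k" using Suc.prems[of "Suc k"] by (simp add: d_def c_def)
  qed
  have e: "e (Suc k) = c (Suc k) + d k" for k by (simp add: d_def c_def)
  have e0: "e 0 = c 0" using Suc.prems[of 0] by (simp add: c_def)
  have cn: "c (Suc n) = 0" by (simp add: c_def binomial_eq_0)
  have "bern_sum e (Suc n) l
    = of_nat (c 0) * (1 - l) ^ Suc n + (\<Sum>k\<le>n. of_nat (c (Suc k)) * l ^ Suc k * (1 - l) ^ (n - k))
      + (\<Sum>k\<le>n. of_nat (d k) * l ^ Suc k * (1 - l) ^ (n - k))"
    unfolding bern_sum_def sum.atMost_Suc_shift
    by (simp add: e e0 algebra_simps sum.distrib del: power_Suc)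
  also have "of_nat (c 0) * (1 - l) ^ Suc n + (\<Sum>k\<le>n. of_nat (c (Suc k)) * l ^ Suc k * (1 - l) ^ (n - k))
     = (\<Sum>k\<le>Suc n. of_nat (c k) * l ^ k * (1 - l) ^ (Suc n - k))"
    unfolding sum.atMost_Suc_shift by simp
  also have "\<dots> = (\<Sum>k\<le>n. of_nat (c k) * l ^ k * (1 - l) ^ (Suc n - k))"
    by (simp add: cn)
  also have "\<dots> = (1 - l) * bern_sum c n l"
    unfolding bern_sum_def sum_distrib_left by (intro sum.cong) (auto simp: Suc_diff_le)
  also have "(\<Sum>k\<le>n. of_nat (d k) * l ^ Suc k * (1 - l) ^ (n - k)) = l * bern_sum d n l"
    unfolding bern_sum_def sum_distrib_left by (intro sum.cong) auto
  finally show ?case using R_affine[OF c d R_self] by simp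
qed

text \<open>Leaves every interior coefficient of a Bernstein sum of degree \<open>n\<close> free to
  take all values from 0 to \<open>n\<close>.\<close>

lemma binomial_ge_self:
  assumes "0 < k" "k < n"
  shows "n \<le> n choose k"
  using assms
proof (induction n arbitrary: k)
  case (Suc n)
  obtain i where i: "k = Suc i" using Suc.prems by (cases k) auto
  consider "i = 0" | "k = n" | "0 < i" "k < n" using Suc.prems i by linarith
  then show ?case
  proof cases
    case 3
    then have "n \<le> n choose i" "n \<le> n choose Suc i" using Suc.IH[of i] Suc.IH[of k] i by auto
    moreover have "n > 0" using 3 by simp
    ultimately have "Suc n \<le> (n choose i) + (n choose Suc i)" by linarith
    then show ?thesis by (simp add: i)
  qed (auto simp: i)
qed simp

lemma norm_bern_sum_le:
  assumes "\<And>k. k \<le> n \<Longrightarrow> e k \<le> n choose k"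
  shows "norm (bern_sum e n l) \<le> (norm l + norm (1 - l)) ^ n"
proof -
  have "norm (bern_sum e n l) \<le> (\<Sum>k\<le>n. norm (of_nat (e k) * l ^ k * (1 - l) ^ (n - k)))"
    unfolding bern_sum_def by (rule norm_sum)
  also have "\<dots> \<le> (\<Sum>k\<le>n. of_nat (n choose k) * norm l ^ k * norm (1 - l) ^ (n - k))"
    using assms by (intro sum_mono) (auto simp: norm_mult norm_power intro!: mult_right_mono)
  also have "\<dots> = (norm l + norm (1 - l)) ^ n" by (simp add: binomial_ring)
  finally show ?thesis .
qed

text \<open>The pigeonholes are square cells of side 1/2, small enough that the two coordinate
  differences add up to less than 1.\<close>

lemma floor_pair_eq_imp_close:
  fixes a b :: complex
  assumes "\<lfloor>2 * Re a\<rfloor> = \<lfloor>2 * Re b\<rfloor>" "\<lfloor>2 * Im a\<rfloor> = \<lfloor>2 * Im b\<rfloor>"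
  shows "norm (a - b) < 1"
proof -
  have "\<bar>2 * Re a - 2 * Re b\<bar> < 1" "\<bar>2 * Im a - 2 * Im b\<bar> < 1"
    using assms by linarith+
  then have "\<bar>Re (a - b)\<bar> < 1 / 2" "\<bar>Im (a - b)\<bar> < 1 / 2"
    unfolding minus_complex.sel by linarith+
  then show ?thesis using cmod_le[of "a - b"] by linarith
qed

text \<open>Up to degree \<open>n\<close> there are superexponentially many coefficient sequences, but the values at
  \<open>l\<close> lie in a disc whose radius is only exponential in \<open>n\<close>.\<close>

lemma close_bern_sums:
  obtains n e e' where "\<And>k. k \<le> n \<Longrightarrow> e k \<le> n choose k" "\<And>k. k \<le> n \<Longrightarrow> e' k \<le> n choose k"
    "\<exists>k\<le>n. e k \<noteq> e' k" "norm (bern_sum e n l - bern_sum e' n l) < 1"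
proof -
  define M where "M = norm l + norm (1 - l)"
  have M: "M \<ge> 1" using norm_triangle_ineq[of l "1 - l"] by (simp add: M_def)
  \<comment> \<open>At most \<open>(9 * M ^ n)^2 = 81 * M ^ (2 * n)\<close> cells occur. For
    \<open>n \<ge> 2\<close> this is at most \<open>(81 * M ^ 4) ^ (n - 1)\<close>, so
    \<open>n \<ge> 81 * M ^ 4\<close> keeps it below the number \<open>(n + 1) ^ (n - 1)\<close> of
    sequences.\<close>
  obtain n0 :: nat where n0: "81 * M ^ 4 \<le> real n0" using real_arch_simple by blast
  define n where "n = max n0 2"
  have n: "81 * M ^ 4 \<le> real n" "n \<ge> 2" using n0 by (auto simp: n_def)
  \<comment> \<open>Only interior coefficients vary. The two end ones, whose binomial bound is 1,
    are set to 0 by \<open>ext\<close>.\<close>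
  define A where "A = PiE {1..<n} (\<lambda>_. {..n})"
  define ext where "ext e k = (if k \<in> {1..<n} then e k else 0)" for e :: "nat \<Rightarrow> nat" and k
  have ext_le: "ext e k \<le> n choose k" if "e \<in> A" for e k
    using that binomial_ge_self[of k n]
    by (fastforce simp: ext_def A_def PiE_def Pi_def)
  define F where "F e = (\<lfloor>2 * Re (bern_sum (ext e) n l)\<rfloor>, \<lfloor>2 * Im (bern_sum (ext e) n l)\<rfloor>)" for e
  \<comment> \<open>The \<open>+ 1\<close> absorbs the rounding down of negative values.\<close>
  define Z where "Z = \<lfloor>2 * M ^ n\<rfloor> + 1"
  have Mn: "M ^ n \<ge> 1" using M by simp
  have "F ` A \<subseteq> {-Z..Z} \<times> {-Z..Z}"
  proof
    fix p assume "p \<in> F ` A"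
    then obtain e where e: "e \<in> A" "p = F e" by auto
    have "norm (bern_sum (ext e) n l) \<le> M ^ n"
      unfolding M_def by (rule norm_bern_sum_le) (rule ext_le[OF e(1)])
    then have "\<bar>Re (bern_sum (ext e) n l)\<bar> \<le> M ^ n" "\<bar>Im (bern_sum (ext e) n l)\<bar> \<le> M ^ n"
      using abs_Re_le_cmod abs_Im_le_cmod order_trans by blast+
    then show "p \<in> {-Z..Z} \<times> {-Z..Z}"
      unfolding e(2) F_def Z_def by (auto; linarith)
  qed
  then have "card (F ` A) \<le> card ({-Z..Z} \<times> {-Z..Z})" by (intro card_mono) auto
  also have "\<dots> = nat (2 * Z + 1) ^ 2" by (simp add: card_cartesian_product power2_eq_square)
  finally have c1: "card (F ` A) \<le> nat (2 * Z + 1) ^ 2" .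
  have "real (nat (2 * Z + 1)) \<le> 9 * M ^ n"
    using Mn of_int_floor_le[of "2 * M ^ n"] by (simp add: Z_def del: of_int_floor_le)
  then have "real (nat (2 * Z + 1)) ^ 2 \<le> (9 * M ^ n) ^ 2" by (intro power_mono) auto
  also have "\<dots> = 81 * M ^ (2 * n)" by (simp add: power_mult_distrib power_mult[symmetric] mult.commute)
  also have "\<dots> \<le> 81 ^ (n - 1) * M ^ (4 * (n - 1))"
  proof (rule mult_mono)
    show "(81::real) \<le> 81 ^ (n - 1)" using n(2) by (intro self_le_power) auto
    show "M ^ (2 * n) \<le> M ^ (4 * (n - 1))" using n(2) M by (intro power_increasing) auto
  qed (use M in auto)
  also have "\<dots> = (81 * M ^ 4) ^ (n - 1)" by (simp add: power_mult_distrib power_mult)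
  also have "\<dots> \<le> real n ^ (n - 1)" using n M by (intro power_mono) auto
  also have "\<dots> < real (Suc n) ^ (n - 1)" using n(2) by (intro power_strict_mono) auto
  also have "\<dots> = real (card A)" by (simp add: A_def card_PiE)
  finally have "real (nat (2 * Z + 1) ^ 2) < real (card A)" by simp
  with c1 have "card (F ` A) < card A" by linarith
  then have "\<not> inj_on F A" by (rule pigeonhole)
  then obtain e e' where ee: "e \<in> A" "e' \<in> A" "e \<noteq> e'" "F e = F e'" by (auto simp: inj_on_def)
  then obtain k where "k \<in> {1..<n}" "e k \<noteq> e' k"
    unfolding A_def by (metis PiE_ext)
  then have "\<exists>k\<le>n. ext e k \<noteq> ext e' k" by (intro exI[of _ k]) (auto simp: ext_def)
  with ee show ?thesis
    by (intro that[of n "ext e" "ext e'"] ext_le floor_pair_eq_imp_close) (auto simp: F_def)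
qed

text \<open>For \<open>l \<noteq> 1\<close>, division by \<open>(1 - l) ^ n\<close> turns the
  difference into an ordinary nonzero polynomial in \<open>z = l / (1 - l)\<close>, and
  \<open>l\<close> is recovered as \<open>z / (1 + z)\<close>.\<close>

lemma finite_zeros_bern_sum_diff:
  assumes "\<exists>k\<le>n. e k \<noteq> e' k"
  shows "finite {l. bern_sum e n l = bern_sum e' n l}"
proof -
  define c where "c k = (of_nat (e k) - of_nat (e' k) :: complex)" for k
  let ?Q = "{z. (\<Sum>k\<le>n. c k * z ^ k) = 0}"
  have "finite ?Q"
    using assms polyfun_finite_roots[of c n] by (auto simp: c_def)
  moreover have "{l. bern_sum e n l = bern_sum e' n l} \<subseteq> insert 1 ((\<lambda>z. z / (1 + z)) ` ?Q)"
  proof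
    fix l assume l: "l \<in> {l. bern_sum e n l = bern_sum e' n l}"
    show "l \<in> insert 1 ((\<lambda>z. z / (1 + z)) ` ?Q)"
    proof (cases "l = 1")
      case False
      have "0 = bern_sum e n l - bern_sum e' n l" using l by simp
      also have "\<dots> = (\<Sum>k\<le>n. c k * l ^ k * (1 - l) ^ (n - k))"
        by (simp add: bern_sum_def c_def sum_subtractf[symmetric] algebra_simps)
      also have "\<dots> = (1 - l) ^ n * (\<Sum>k\<le>n. c k * (l / (1 - l)) ^ k)"
        unfolding sum_distrib_left using False
        by (intro sum.cong) (auto simp: power_divide power_diff field_simps)
      finally have "l / (1 - l) \<in> ?Q" using False by simp
      moreover have "l = (l / (1 - l)) / (1 + l / (1 - l))" using False by (simp add: field_simps)
      ultimately show ?thesis by blast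
    qed simp
  qed
  ultimately show ?thesis using finite_subset by blast
qed

section \<open>Small differences and large elements\<close>

text \<open>Interpolating from \<open>f\<close> to \<open>g\<close> with parameters \<open>a\<close>
  and \<open>b\<close> gives two elements whose difference is \<open>(b - a) * (g - f)\<close>.
  Starting from \<open>1 - 0\<close>, every power of \<open>b - a\<close> is thus a
  difference.\<close>

lemma small_differences:
  assumes ab: "a \<in> R l" "b \<in> R l" "a \<noteq> b" "norm (b - a) < 1" and "\<epsilon> > 0"
  obtains f g where "f \<in> R l" "g \<in> R l" "f \<noteq> g" "norm (g - f) < \<epsilon>"
proof -
  have *: "\<exists>f\<in>R l. \<exists>g\<in>R l. g - f = (b - a) ^ n" for n
  proof (induction n)
    case 0
    show ?case by (intro bexI[of _ 0] bexI[of _ 1]) auto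
  next
    case (Suc n)
    then obtain f g where fg: "f \<in> R l" "g \<in> R l" "g - f = (b - a) ^ n" by blast
    show ?case
    proof (intro bexI)
      have "((1 - b) * f + b * g) - ((1 - a) * f + a * g) = (b - a) * (g - f)"
        by (simp add: algebra_simps)
      then show "((1 - b) * f + b * g) - ((1 - a) * f + a * g) = (b - a) ^ Suc n" using fg by simp
    qed (use ab fg R_affine in auto)
  qed
  have "\<exists>n. norm (b - a) ^ n < \<epsilon>" using assms by (intro real_arch_pow_inv)
  then obtain n where n: "norm (b - a) ^ n < \<epsilon>" by blast
  from * obtain f g where "f \<in> R l" "g \<in> R l" "g - f = (b - a) ^ n" by blast
  with n ab(3) show ?thesis by (intro that[of f g]) (auto simp: norm_power)
qed

lemma R_01:
  assumes "l = 0 \<or> l = 1"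
  shows "R l \<subseteq> {0, 1}"
  using assms by (intro R_smallest(3)) (auto simp: lam_clonvex_def lam_convex_def)

text \<open>If no element had norm above 1, any \<open>x\<close> other than 0 and 1 would satisfy
  \<open>norm x = norm (1 - x) = 1\<close>. Then \<open>x ^ 3 = -1\<close>, and
  \<open>1 - x ^ 3 = 2\<close> would be too large. So \<open>R l\<close> would be within
  \<open>{0, 1}\<close>, which has no two distinct points closer than 1. Powers of an element of
  norm above 1 do the rest.\<close>

lemma R_unbounded:
  assumes ab: "a \<in> R l" "b \<in> R l" "a \<noteq> b" "norm (b - a) < 1"
    and big: "\<And>x. x \<in> R l \<Longrightarrow> x \<noteq> 0 \<Longrightarrow> norm x \<ge> 1"
  obtains t where "t \<in> R l" "norm (1 - t) \<ge> B"
proof -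
  have "\<exists>r\<in>R l. norm r > 1"
  proof (rule ccontr)
    assume "\<not> ?thesis"
    then have le: "norm x \<le> 1" if "x \<in> R l" for x using that by fastforce
    have "x = 0 \<or> x = 1" if x: "x \<in> R l" for x
    proof (rule ccontr)
      assume n: "\<not> ?thesis"
      have "norm x = 1" "norm (1 - x) = 1"
        using n x le[of x] le[of "1 - x"] big[of x] big[of "1 - x"] R_diff[of x l] by auto
      then have sq: "Re x ^ 2 + Im x ^ 2 = 1" "(1 - Re x) ^ 2 + Im x ^ 2 = 1"
        using cmod_power2[of x] cmod_power2[of "1 - x"] by simp_all
      moreover have "(1 - Re x) ^ 2 = 1 - 2 * Re x + Re x ^ 2"
        by (simp add: power2_diff)
      ultimately have re: "Re x = 1 / 2" by linarith
      then have im: "Im x ^ 2 = 3 / 4" using sq(1) by (simp only: re) (simp add: power2_eq_square)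
      have "x * x = x - 1"
        using im by (simp add: complex_eq_iff re power2_eq_square)
      then have "x ^ 3 = -1" by (simp add: power3_eq_cube left_diff_distrib)
      then have "1 - x ^ 3 = 2" by simp
      then have "2 \<in> R l" using R_diff[OF R_power[OF x, of 3]] by (simp only:)
      then show False using le[of 2] by simp
    qed
    then have "a \<in> {0, 1}" "b \<in> {0, 1}" using ab by auto
    then show False using ab by auto
  qed
  then obtain r where r: "r \<in> R l" "norm r > 1" by blast
  obtain n where n: "B + 1 < norm r ^ n" using real_arch_pow[OF r(2)] by blast
  have "B \<le> norm (1 - r ^ n)"
    using n norm_triangle_ineq2[of "r ^ n" 1] by (simp add: norm_power norm_minus_commute)
  then show ?thesis using r by (intro that[of "r ^ n"] R_power)
qed

section \<open>Approximation inside the real hull\<close>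

text \<open>The real subalgebra generated by \<open>l\<close>: \<open>\<real>\<close> or the whole plane.\<close>

definition real_hull :: "complex \<Rightarrow> complex set" where
  "real_hull l = {x. l \<in> \<real> \<longrightarrow> x \<in> \<real>}"

lemma R_subset_real_hull: "R l \<subseteq> real_hull l"
proof (rule R_smallest(3))
  have "real_hull l = (if l \<in> \<real> then \<real> else UNIV)" by (auto simp: real_hull_def)
  then show "lam_clonvex l (real_hull l)"
    by (auto simp: lam_clonvex_def lam_convex_def closed_complex_Reals)
qed (auto simp: real_hull_def)

text \<open>For non-real \<open>l\<close>, the numbers \<open>1 - l\<close> and \<open>l\<close>
  form a real basis of the plane, and \<open>K\<close> bounds the coordinate maps. For real
  \<open>l\<close> they sum to 1, so equal coordinates work.\<close>

lemma real_hull_coords: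
  obtains K where "K \<ge> 1"
    "\<And>x. x \<in> real_hull l \<Longrightarrow> \<exists>\<alpha> \<beta>. x = of_real \<alpha> * (1 - l) + of_real \<beta> * l
        \<and> \<bar>\<alpha>\<bar> \<le> K * norm x \<and> \<bar>\<beta>\<bar> \<le> K * norm x"
proof (cases "l \<in> \<real>")
  case True
  show ?thesis
  proof (rule that[of 1])
    fix x assume "x \<in> real_hull l"
    then have "x \<in> \<real>" using True by (auto simp: real_hull_def)
    then obtain y where "x = of_real y" by (auto elim: Reals_cases)
    then show "\<exists>\<alpha> \<beta>. x = of_real \<alpha> * (1 - l) + of_real \<beta> * l \<and> \<bar>\<alpha>\<bar> \<le> 1 * norm x \<and> \<bar>\<beta>\<bar> \<le> 1 * norm x"
      by (intro exI[of _ y]) (auto simp: algebra_simps)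
  qed simp
next
  case False
  then have i: "Im l \<noteq> 0" by (simp add: complex_is_Real_iff)
  define K where "K = 2 + (\<bar>Re l\<bar> + 1) / \<bar>Im l\<bar>"
  show ?thesis
  proof (rule that[of K])
    show "1 \<le> K" by (simp add: K_def add_increasing2)
    fix x
    define d where "d = Im x / Im l"
    define \<alpha> where "\<alpha> = Re x - d * Re l"
    have x: "x = of_real \<alpha> * (1 - l) + of_real (\<alpha> + d) * l"
      using i by (simp add: complex_eq_iff \<alpha>_def d_def field_simps)
    have d: "\<bar>d\<bar> \<le> norm x / \<bar>Im l\<bar>"
      by (simp add: d_def abs_Im_le_cmod divide_right_mono)
    have "\<bar>d * Re l\<bar> \<le> norm x / \<bar>Im l\<bar> * \<bar>Re l\<bar>"
      using d by (simp only: abs_mult mult_right_mono abs_ge_zero)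
    then have a: "\<bar>\<alpha>\<bar> \<le> norm x + norm x / \<bar>Im l\<bar> * \<bar>Re l\<bar>"
      using abs_Re_le_cmod[of x] unfolding \<alpha>_def by linarith
    have "K * norm x = 2 * norm x + norm x / \<bar>Im l\<bar> * \<bar>Re l\<bar> + norm x / \<bar>Im l\<bar>"
      by (simp add: K_def algebra_simps add_divide_distrib)
    moreover have "norm x / \<bar>Im l\<bar> \<ge> 0" by simp
    ultimately have "\<bar>\<alpha>\<bar> \<le> K * norm x" "\<bar>\<alpha> + d\<bar> \<le> K * norm x"
      using a d norm_ge_zero[of x] by linarith+
    with x show "\<exists>\<alpha> \<beta>. x = of_real \<alpha> * (1 - l) + of_real \<beta> * l
        \<and> \<bar>\<alpha>\<bar> \<le> K * norm x \<and> \<bar>\<beta>\<bar> \<le> K * norm x" by blast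
  qed
qed

lemma real_hull_R: "x \<in> R l \<Longrightarrow> x \<in> real_hull l"
  using R_subset_real_hull by blast

lemma real_hull_intros:
  "x \<in> real_hull l \<Longrightarrow> y \<in> real_hull l \<Longrightarrow> x + y \<in> real_hull l"
  "x \<in> real_hull l \<Longrightarrow> y \<in> real_hull l \<Longrightarrow> x - y \<in> real_hull l"
  "x \<in> real_hull l \<Longrightarrow> y \<in> real_hull l \<Longrightarrow> x * y \<in> real_hull l"
  "x \<in> real_hull l \<Longrightarrow> y \<in> real_hull l \<Longrightarrow> x / y \<in> real_hull l"
  "of_real r \<in> real_hull l"
  by (auto simp: real_hull_def)

text \<open>A Bernstein sum of degree \<open>n + 2\<close> with only the coefficients 1 and 2
  present; their terms share the factor \<open>l * (1 - l) ^ n\<close>.\<close>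

lemma parallelogram_in_R:
  assumes "i \<le> n" "j \<le> n"
  shows "l * (1 - l) ^ n * (of_nat i * (1 - l) + of_nat j * l) \<in> R l"
proof -
  define e where "e k = (if k = 1 then i else if k = 2 then j else 0)" for k :: nat
  have "j \<le> Suc (Suc n) choose 2"
    using binomial_ge_self[of 2 "Suc (Suc n)"] assms by (cases "n = 0") auto
  then have "bern_sum e (Suc (Suc n)) l \<in> R l"
    using assms by (intro bern_sum_in_R) (auto simp: e_def)
  also have "bern_sum e (Suc (Suc n)) l
    = (\<Sum>k\<in>{1, 2}. of_nat (e k) * l ^ k * (1 - l) ^ (Suc (Suc n) - k))"
    unfolding bern_sum_def by (rule sum.mono_neutral_right) (auto simp: e_def)
  also have "\<dots> = l * (1 - l) ^ n * (of_nat i * (1 - l) + of_nat j * l)"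
    by (simp add: e_def algebra_simps power2_eq_square)
  finally show ?thesis .
qed

lemma nearby_nat:
  assumes "\<bar>\<alpha> - real n / 2\<bar> \<le> real n / 2"
  obtains i where "i \<le> n" "\<bar>real i - \<alpha>\<bar> \<le> 1"
proof (rule that[of "nat \<lfloor>\<alpha>\<rfloor>"])
  have "0 \<le> \<alpha>" "\<alpha> \<le> real n" using assms unfolding abs_le_iff by linarith+
  then show "nat \<lfloor>\<alpha>\<rfloor> \<le> n" "\<bar>real (nat \<lfloor>\<alpha>\<rfloor>) - \<alpha>\<bar> \<le> 1" by linarith+
qed

text \<open>The grid has centre \<open>n / 2\<close>, as \<open>1 - l\<close> and \<open>l\<close>
  sum to 1. Within distance \<open>n / (2 * K)\<close> of it both coordinates lie between 0 and
  \<open>n\<close>, and rounding them costs at most \<open>norm l + norm (1 - l)\<close> before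
  scaling.\<close>

lemma dense_patch:
  assumes K: "K \<ge> 1"
    "\<And>x. x \<in> real_hull l \<Longrightarrow> \<exists>\<alpha> \<beta>. x = of_real \<alpha> * (1 - l) + of_real \<beta> * l
        \<and> \<bar>\<alpha>\<bar> \<le> K * norm x \<and> \<bar>\<beta>\<bar> \<le> K * norm x"
    and w: "w \<in> real_hull l" "norm (w - of_nat n / 2) \<le> real n / (2 * K)"
  shows "\<exists>x\<in>R l. norm (x - l * (1 - l) ^ n * w)
    \<le> norm (l * (1 - l) ^ n) * (norm l + norm (1 - l))"
proof -
  have "of_nat n / 2 \<in> real_hull l" by (auto simp: real_hull_def)
  from K(2)[OF real_hull_intros(2)[OF w(1) this]]
  obtain \<alpha> \<beta> where ab: "w - of_nat n / 2 = of_real \<alpha> * (1 - l) + of_real \<beta> * l"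
    "\<bar>\<alpha>\<bar> \<le> K * norm (w - of_nat n / 2)" "\<bar>\<beta>\<bar> \<le> K * norm (w - of_nat n / 2)" by blast
  have "K * norm (w - of_nat n / 2) \<le> real n / 2"
    using w(2) K(1) by (simp add: field_simps)
  then have "\<bar>(\<alpha> + real n / 2) - real n / 2\<bar> \<le> real n / 2"
    "\<bar>(\<beta> + real n / 2) - real n / 2\<bar> \<le> real n / 2" using ab by auto
  then obtain i j where i: "i \<le> n" "\<bar>real i - (\<alpha> + real n / 2)\<bar> \<le> 1"
    and j: "j \<le> n" "\<bar>real j - (\<beta> + real n / 2)\<bar> \<le> 1"
    using nearby_nat by metis
  define u v where "u = real i - (\<alpha> + real n / 2)" and "v = real j - (\<beta> + real n / 2)"
  have w': "w = of_nat n / 2 + (of_real \<alpha> * (1 - l) + of_real \<beta> * l)"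
    using ab(1) by (simp add: algebra_simps)
  have "(of_nat i * (1 - l) + of_nat j * l) - w = of_real u * (1 - l) + of_real v * l"
    unfolding w' u_def v_def by (simp add: field_simps)
  also have "norm \<dots> \<le> \<bar>u\<bar> * norm (1 - l) + \<bar>v\<bar> * norm l"
    using norm_triangle_ineq[of "of_real u * (1 - l)" "of_real v * l"] by (simp add: norm_mult)
  also have "\<dots> \<le> 1 * norm (1 - l) + 1 * norm l"
    using i j by (intro add_mono mult_right_mono) (auto simp: u_def v_def)
  finally have "norm ((of_nat i * (1 - l) + of_nat j * l) - w) \<le> norm l + norm (1 - l)" by simp
  then have "norm (l * (1 - l) ^ n) * norm ((of_nat i * (1 - l) + of_nat j * l) - w)
    \<le> norm (l * (1 - l) ^ n) * (norm l + norm (1 - l))"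
    by (rule mult_left_mono) simp
  then show ?thesis
    by (intro bexI[OF _ parallelogram_in_R[OF i(1) j(1)]])
       (simp only: norm_mult[symmetric] right_diff_distrib)
qed

text \<open>Targets are confined to \<open>real_hull l\<close> because for real \<open>l\<close>
  nothing off the real line can be approximated.\<close>

definition dense_in_disc :: "complex \<Rightarrow> real \<Rightarrow> real \<Rightarrow> bool" where
  "dense_in_disc l L \<sigma> \<longleftrightarrow> (\<forall>w\<in>real_hull l. norm w \<le> L \<longrightarrow> (\<exists>x\<in>R l. norm (x - w) \<le> \<sigma>))"

text \<open>The patch of \<open>dense_patch\<close> is centred at \<open>c = q n / 2\<close>, at a distance \<open>K\<close> times its radius from the
  origin. Applying \<open>a \<mapsto> (1 - t) a + t b\<close> with \<open>b\<close> near \<open>c\<close> magnifies it about \<open>c\<close> until it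
  covers a disc around \<open>0\<close>; the density deteriorates only by the factor \<open>\<bar>1 - t\<bar>\<close>, which does not
  depend on \<open>n\<close>.\<close>

lemma dense_in_disc_initial:
  fixes l t :: complex and n :: nat
  defines "q \<equiv> l * (1 - l) ^ n" and "\<rho> \<equiv> norm l + norm (1 - l)"
  assumes K: "K \<ge> 1"
    "\<And>x. x \<in> real_hull l \<Longrightarrow> \<exists>\<alpha> \<beta>. x = of_real \<alpha> * (1 - l) + of_real \<beta> * l
        \<and> \<bar>\<alpha>\<bar> \<le> K * norm x \<and> \<bar>\<beta>\<bar> \<le> K * norm x"
    and t: "t \<in> R l" "norm (1 - t) \<ge> 4 * (K + 1)"
    and q: "q \<noteq> 0" and n: "4 * \<rho> \<le> real n / (2 * K)"
  shows "dense_in_disc l (norm q * (real n / (2 * K))) (norm (1 - t) * (norm q * \<rho>))"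
  unfolding dense_in_disc_def
proof (intro ballI impI)
  fix w assume w: "w \<in> real_hull l" "norm w \<le> norm q * (real n / (2 * K))"
  define T where "T = norm (1 - t)"
  define L where "L = norm q * (real n / (2 * K))"
  define c where "c = q * (of_nat n / 2)"
  have T: "T \<ge> 4 * (K + 1)" "T \<ge> 1" "1 - t \<noteq> 0" using t(2) K(1) by (auto simp: T_def)
  have L0: "L \<ge> 0" using K(1) by (simp add: L_def)
  have \<rho>L: "4 * (norm q * \<rho>) \<le> L"
    using mult_left_mono[OF n, of "norm q"] by (simp add: L_def mult_ac)
  have c: "norm c = K * L" using K(1) by (simp add: c_def L_def norm_mult norm_divide)
  have half: "of_nat n / 2 \<in> real_hull l" by (auto simp: real_hull_def)
  have qE: "q \<in> real_hull l" unfolding q_def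
    by (intro real_hull_intros real_hull_R R_mult R_power R_diff R_self)
  obtain b where b: "b \<in> R l" "norm (b - c) \<le> norm q * \<rho>"
    using dense_patch[OF K half, of n] K(1) unfolding c_def q_def \<rho>_def by auto
  \<comment> \<open>The exact solution of \<open>(1 - t) * v + t * b = w\<close>. It must lie in the
    patch, so that some \<open>a\<close> in \<open>R l\<close> can replace it.\<close>
  define v where "v = (w - t * b) / (1 - t)"
  have vE: "v \<in> real_hull l"
    unfolding v_def by (intro real_hull_intros w(1) real_hull_R[OF b(1)]
        real_hull_R[OF t(1)] real_hull_R[OF R_1])
  have "v - c = (w - c - t * (b - c)) / (1 - t)"
    using T(3) by (simp add: v_def field_simps)
  then have "norm (v - c) = norm (w - c - t * (b - c)) / T" by (simp add: T_def norm_divide)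
  also have "norm (w - c - t * (b - c)) \<le> norm w + norm c + norm t * norm (b - c)"
    by (metis norm_mult norm_triangle_ineq4 norm_triangle_le_diff add_right_mono order_trans)
  also have "norm t * norm (b - c) \<le> 2 * T * (L / 4)"
  proof (rule mult_mono)
    show "norm t \<le> 2 * T"
      using norm_triangle_ineq4[of 1 "1 - t"] T by (simp add: T_def)
  qed (use b \<rho>L T in auto)
  \<comment> \<open>The bound \<open>T \<ge> 4 * (K + 1)\<close> makes
    \<open>norm w + norm c\<close>, at most \<open>(K + 1) * L\<close>, a quarter of
    \<open>T * L\<close>; the error in \<open>b\<close> takes at most half.\<close>
  also have "norm w + norm c + 2 * T * (L / 4) \<le> T * L"
  proof -
    have "(K + 1) * L \<le> T / 4 * L" using T(1) L0 by (intro mult_right_mono) auto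
    moreover have "norm w \<le> L" using w(2) by (simp add: L_def)
    ultimately have "norm w + norm c \<le> T * L / 4" by (simp add: c algebra_simps)
    moreover have "T * L \<ge> 0" using T L0 by simp
    ultimately show ?thesis by (simp add: field_simps)
  qed
  finally have vc: "norm (v - c) \<le> L" using T(2) by (simp add: divide_right_mono field_simps)
  have "norm (v / q - of_nat n / 2) = norm (v - c) / norm q"
    using q by (simp add: c_def norm_divide[symmetric] diff_divide_distrib)
  also have "\<dots> \<le> real n / (2 * K)" using vc q by (simp add: L_def field_simps)
  finally obtain a where a: "a \<in> R l" "norm (a - q * (v / q)) \<le> norm q * \<rho>"
    using dense_patch[OF K real_hull_intros(4)[OF vE qE], of n] unfolding q_def \<rho>_def by blast
  then have a: "a \<in> R l" "norm (a - v) \<le> norm q * \<rho>" using q by auto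
  have "(1 - t) * a + t * b - w = (1 - t) * (a - v)"
    using T(3) by (simp add: v_def field_simps)
  then have "norm ((1 - t) * a + t * b - w) \<le> norm (1 - t) * (norm q * \<rho>)"
    using a(2) by (simp add: norm_mult mult_left_mono)
  then show "\<exists>x\<in>R l. norm (x - w) \<le> norm (1 - t) * (norm q * \<rho>)"
    using R_affine a(1) b(1) t(1) by blast
qed

text \<open>A two-stage correction. Approximating with \<open>s\<close> alone leaves a remainder of
  norm at most \<open>\<theta> * L\<close>. Divided by \<open>t * (g - f)\<close>, of norm
  \<open>\<theta>\<close>, it lies in the disc again, and a second approximation \<open>u\<close>
  has its error \<open>\<sigma>\<close> scaled by \<open>\<theta>\<close>.\<close>

lemma dense_in_disc_step:
  fixes f g t :: complex
  defines "\<theta> \<equiv> norm t * norm (g - f)"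
  assumes R: "f \<in> R l" "g \<in> R l" "t \<in> R l"
    and T: "norm (1 - t) \<ge> 2" and \<theta>: "\<theta> > 0" and L: "norm t * norm f \<le> L"
    and \<sigma>: "norm (1 - t) * \<sigma> \<le> \<theta> * L" and dense: "dense_in_disc l L \<sigma>"
  shows "dense_in_disc l L (\<theta> * \<sigma>)"
  unfolding dense_in_disc_def
proof (intro ballI impI)
  fix w assume w: "w \<in> real_hull l" "norm w \<le> L"
  define \<delta> where "\<delta> = t * (g - f)"
  have \<delta>: "norm \<delta> = \<theta>" "\<delta> \<noteq> 0" using \<theta> by (auto simp: \<delta>_def \<theta>_def norm_mult)
  have t1: "1 - t \<noteq> 0" using T by auto
  note intros = real_hull_intros(1-4) real_hull_R[OF R_1] real_hull_R[OF R(1)]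
    real_hull_R[OF R(2)] real_hull_R[OF R(3)] w(1)
  define v where "v = (w - t * f) / (1 - t)"
  have "norm (w - t * f) \<le> 2 * L"
    using norm_triangle_ineq4[of w "t * f"] w(2) L by (simp add: norm_mult)
  also have "\<dots> \<le> norm (1 - t) * L"
    using T L by (intro mult_right_mono) (auto intro: order_trans[rotated])
  finally have "norm v \<le> L" using t1 by (simp add: v_def norm_divide field_simps)
  moreover have "v \<in> real_hull l" unfolding v_def by (intro intros)
  ultimately obtain s where s: "s \<in> R l" "norm (s - v) \<le> \<sigma>"
    using dense unfolding dense_in_disc_def by blast
  define z where "z = (w - t * f - (1 - t) * s) / \<delta>"
  have "w - t * f - (1 - t) * s = (1 - t) * (v - s)"
    using t1 by (simp add: v_def field_simps)
  then have "norm (w - t * f - (1 - t) * s) \<le> norm (1 - t) * \<sigma>"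
    using s(2) by (simp add: norm_mult norm_minus_commute mult_left_mono)
  also note \<sigma>
  finally have "norm z \<le> L" using \<theta> by (simp add: z_def norm_divide \<delta> field_simps)
  moreover have "z \<in> real_hull l"
    unfolding z_def \<delta>_def by (intro intros real_hull_R[OF s(1)])
  ultimately obtain u where u: "u \<in> R l" "norm (u - z) \<le> \<sigma>"
    using dense unfolding dense_in_disc_def by blast
  have "(1 - t) * s + t * ((1 - u) * f + u * g) - w = \<delta> * u - (w - t * f - (1 - t) * s)"
    by (simp add: \<delta>_def algebra_simps)
  also have "w - t * f - (1 - t) * s = \<delta> * z" using \<delta> by (simp add: z_def)
  also have "\<delta> * u - \<delta> * z = \<delta> * (u - z)" by (rule right_diff_distrib[symmetric])
  finally have "norm ((1 - t) * s + t * ((1 - u) * f + u * g) - w) \<le> \<theta> * \<sigma>"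
    using u(2) \<theta> by (simp add: norm_mult \<delta>)
  moreover have "(1 - t) * s + t * ((1 - u) * f + u * g) \<in> R l"
    using R s u by (intro R_affine)
  ultimately show "\<exists>x\<in>R l. norm (x - w) \<le> \<theta> * \<sigma>" by blast
qed

text \<open>The refinement step can be repeated, since its condition on \<open>\<sigma>\<close>
  survives shrinking. The errors decay geometrically and \<open>R l\<close> is closed.\<close>

lemma dense_in_disc_imp_mem:
  fixes f g t :: complex
  defines "\<theta> \<equiv> norm t * norm (g - f)"
  assumes R: "f \<in> R l" "g \<in> R l" "t \<in> R l"
    and T: "norm (1 - t) \<ge> 2" and \<theta>: "\<theta> > 0" "\<theta> < 1" and L: "norm t * norm f \<le> L"
    and \<sigma>: "norm (1 - t) * \<sigma> \<le> \<theta> * L" "\<sigma> \<ge> 0" and dense: "dense_in_disc l L \<sigma>"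
    and w: "w \<in> real_hull l" "norm w \<le> L"
  shows "w \<in> R l"
proof -
  have *: "dense_in_disc l L (\<theta> ^ k * \<sigma>)" for k
  proof (induction k)
    case (Suc k)
    have "\<theta> ^ k * \<sigma> \<le> 1 * \<sigma>" using \<theta> \<sigma>(2) by (intro mult_right_mono power_le_one) auto
    then have "norm (1 - t) * (\<theta> ^ k * \<sigma>) \<le> norm (1 - t) * \<sigma>"
      by (simp add: mult_left_mono)
    also note \<sigma>(1)
    finally show ?case
      using dense_in_disc_step[OF R T _ L, of "\<theta> ^ k * \<sigma>"] \<theta>(1) Suc
      by (simp add: \<theta>_def mult_ac)
  qed (use dense in simp)
  have "(\<lambda>k. \<theta> ^ k * \<sigma>) \<longlonglongrightarrow> 0 * \<sigma>"
    using \<theta> by (intro tendsto_intros LIMSEQ_power_zero) auto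
  then have lim: "(\<lambda>k. \<theta> ^ k * \<sigma>) \<longlonglongrightarrow> 0" by simp
  have "\<exists>x\<in>R l. dist x w < \<epsilon>" if "\<epsilon> > 0" for \<epsilon>
  proof -
    have "\<forall>\<^sub>F k in sequentially. \<theta> ^ k * \<sigma> < \<epsilon>" using lim that by (rule order_tendstoD)
    then obtain k where k: "\<theta> ^ k * \<sigma> < \<epsilon>" by (auto simp: eventually_sequentially)
    obtain x where "x \<in> R l" "norm (x - w) \<le> \<theta> ^ k * \<sigma>"
      using *[of k] w unfolding dense_in_disc_def by blast
    with k show ?thesis by (metis dist_norm le_less_trans)
  qed
  then show ?thesis using closed_approachable[OF R_closed] by blast
qed

section \<open>Close elements force convexity, and the theorem\<close>

lemma close_elements_imp_C:
  assumes ab: "a \<in> R l" "b \<in> R l" "a \<noteq> b" "norm (b - a) < 1"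
  shows "l \<in> C_set"
proof (cases "\<exists>x\<in>R l. x \<noteq> 0 \<and> norm x < 1")
  case True
  then show ?thesis using small_element_imp_C by blast
next
  case False
  \<comment> \<open>Without small elements, \<open>big\<close> supplies both the unboundedness of
    \<open>R l\<close> and \<open>norm q \<ge> 1\<close> below.\<close>
  then have big: "norm x \<ge> 1" if "x \<in> R l" "x \<noteq> 0" for x using that by force
  have l01: "l \<noteq> 0" "l \<noteq> 1"
  proof -
    have "\<not> R l \<subseteq> {0, 1}"
    proof
      assume "R l \<subseteq> {0, 1}"
      then have "a \<in> {0, 1}" "b \<in> {0, 1}" using ab by auto
      with ab show False by auto
    qed
    then show "l \<noteq> 0" "l \<noteq> 1" using R_01 by blast+
  qed
  obtain K where K: "K \<ge> 1"
    "\<And>x. x \<in> real_hull l \<Longrightarrow> \<exists>\<alpha> \<beta>. x = of_real \<alpha> * (1 - l) + of_real \<beta> * l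
        \<and> \<bar>\<alpha>\<bar> \<le> K * norm x \<and> \<bar>\<beta>\<bar> \<le> K * norm x"
    using real_hull_coords[of l] by blast
  obtain t where t: "t \<in> R l" "norm (1 - t) \<ge> 4 * (K + 1)"
    using R_unbounded[OF ab big] by blast
  define T where "T = norm (1 - t)"
  have T2: "T \<ge> 2" using t(2) K(1) by (simp add: T_def)
  have t0: "norm t > 0" using t(2) K(1) by auto
  obtain f g where fg: "f \<in> R l" "g \<in> R l" "f \<noteq> g" "norm (g - f) < 1 / norm t"
    using small_differences[OF ab, of "1 / norm t"] t0 by auto
  define \<theta> where "\<theta> = norm t * norm (g - f)"
  have \<theta>: "\<theta> > 0" "\<theta> < 1" using fg t0 by (auto simp: \<theta>_def field_simps)
  define \<rho> where "\<rho> = norm l + norm (1 - l)"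
  \<comment> \<open>The summands secure, in order, \<open>T * \<sigma> \<le> \<theta> * L\<close>,
    the hypothesis on \<open>\<rho>\<close> for the initial density,
    \<open>norm t * norm f \<le> L\<close>, and \<open>L \<ge> 1\<close>, so that 1/2 is in the
    disc. The first works because \<open>\<sigma>\<close> and \<open>L\<close> both scale with
    \<open>norm q\<close>, but only \<open>L\<close> gains the factor \<open>n\<close>. Hence
    \<open>n\<close> is chosen after \<open>t\<close>, \<open>f\<close> and
    \<open>g\<close>.\<close>
  define B where "B = T * (T * \<rho>) / \<theta> + 4 * \<rho> + norm t * norm f + 1"
  have nonneg: "T * (T * \<rho>) / \<theta> \<ge> 0" "\<rho> \<ge> 0" "norm t * norm f \<ge> 0"
    using \<theta> T2 by (auto simp: \<rho>_def)
  obtain n :: nat where "B * (2 * K) \<le> real n" using real_arch_simple by blast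
  then have n: "B \<le> real n / (2 * K)" using K(1) by (simp add: field_simps)
  define q where "q = l * (1 - l) ^ n"
  have q: "q \<noteq> 0" using l01 by (simp add: q_def)
  have q1: "norm q \<ge> 1"
    using q by (intro big) (auto simp: q_def intro!: R_mult R_power R_diff)
  define L where "L = norm q * (real n / (2 * K))"
  define \<sigma> where "\<sigma> = T * (norm q * \<rho>)"
  have "4 * \<rho> \<le> real n / (2 * K)" using n nonneg unfolding B_def by linarith
  then have dense: "dense_in_disc l L \<sigma>"
    using dense_in_disc_initial[OF K t, of n] q unfolding q_def \<rho>_def L_def \<sigma>_def T_def by simp
  have "L \<ge> 1 * B" unfolding L_def using q1 n nonneg
    by (intro mult_mono) (auto simp: B_def)
  then have "B \<le> L" by simp
  then have L: "norm t * norm f \<le> L" "1 \<le> L" using nonneg unfolding B_def by linarith+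
  have "T * (T * \<rho>) / \<theta> \<le> real n / (2 * K)" using n nonneg unfolding B_def by linarith
  then have "T * (T * \<rho>) \<le> \<theta> * (real n / (2 * K))"
    using \<theta>(1) by (simp add: pos_divide_le_eq mult.commute)
  then have "norm q * (T * (T * \<rho>)) \<le> norm q * (\<theta> * (real n / (2 * K)))"
    by (rule mult_left_mono) simp
  then have \<sigma>: "T * \<sigma> \<le> \<theta> * L" by (simp add: \<sigma>_def L_def mult_ac)
  have "\<sigma> \<ge> 0" using T2 nonneg by (simp add: \<sigma>_def)
  have "1 / 2 \<in> R l"
  proof (rule dense_in_disc_imp_mem[OF fg(1,2) t(1)])
    show "dense_in_disc l L \<sigma>" by (rule dense)
    show "1 / 2 \<in> real_hull l" by (auto simp: real_hull_def)
  qed (use T2 \<theta> L \<sigma> \<open>\<sigma> \<ge> 0\<close> in \<open>auto simp: T_def \<theta>_def\<close>)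
  then show ?thesis by (rule small_element_imp_C) auto
qed

theorem theorem7p12:
  shows "(\<forall>l::complex. \<not> l islimpt D_set) \<and>
         (\<forall>l::complex. \<exists>N. open N \<and> l \<in> N \<and> N - {l} \<subseteq> C_set)"
proof -
  have *: "\<exists>N. open N \<and> l \<in> N \<and> N - {l} \<subseteq> C_set" for l
  proof -
    obtain n e e' where e: "\<And>k. k \<le> n \<Longrightarrow> e k \<le> n choose k" "\<And>k. k \<le> n \<Longrightarrow> e' k \<le> n choose k"
      "\<exists>k\<le>n. e k \<noteq> e' k" "norm (bern_sum e n l - bern_sum e' n l) < 1"
      using close_bern_sums[of l] by blast
    define U where "U = {z. norm (bern_sum e n z - bern_sum e' n z) < 1}"
    define Z where "Z = {z. bern_sum e n z = bern_sum e' n z}"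
    have "open U"
      unfolding U_def bern_sum_def by (intro open_Collect_less continuous_intros)
    moreover have "closed (Z - {l})"
      using finite_zeros_bern_sum_diff[OF e(3)] by (intro finite_imp_closed) (simp add: Z_def)
    \<comment> \<open>The two sums may coincide at \<open>l\<close> itself; this zero is kept, as
      the neighbourhood must contain \<open>l\<close>.\<close>
    ultimately have "open (U - (Z - {l}))" by (rule open_Diff)
    moreover have "l \<in> U - (Z - {l})" using e(4) by (simp add: U_def)
    moreover have "z \<in> C_set" if "z \<in> U - (Z - {l}) - {l}" for z
      using that close_elements_imp_C[OF bern_sum_in_R[OF e(2)] bern_sum_in_R[OF e(1)]]
      by (auto simp: U_def Z_def)
    ultimately show ?thesis by blast
  qed
  moreover have "\<not> l islimpt D_set" for l
  proof -
    obtain N where "open N" "l \<in> N" "N - {l} \<subseteq> C_set" using * by blast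
    then show ?thesis unfolding islimpt_def D_set_def by blast
  qed
  ultimately show ?thesis by blast
qed

end
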